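(* For real $x \ge 2$ let \[ S(\alpha) = \sum_{n\le x} \tau(n) e(n\alpha), \qquad e(\alpha)=e^{2\pi i\alpha}, \] where $\tau(n)=\sum_{d\mid n}1$ is the number of positive divisors of $n$. Then there are absolute constants $c_1,c_2>0$ such that for all $x\ge 2$, \[ c_1\sqrt{x} \le \int_0^1 |S(\alpha)|\,d\alpha \le c_2\sqrt{x}\log x . \] In Vinogradov notation: $\sqrt{x} \ll \int_0^1 |S(\alpha)|\,d\alpha \ll \sqrt{x}\log x$.
   Context: $\tau(n)$ denotes the divisor function and $e(\alpha)=e^{2\pi i\alpha}$. The sum over $n\le x$ runs over positive integers $n$. *)

theory Defs
  imports "HOL-Analysis.Analysis"
begin

(* Only used for n > 0: the divisor set of 0 is infinite, so its card is 0. *)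
definition tau :: "nat \<Rightarrow> nat" where
  "tau n = card {d. d dvd n}"

definition e :: "real \<Rightarrow> complex" where
  "e \<alpha> = exp (2 * complex_of_real pi * \<i> * complex_of_real \<alpha>)"

definition S :: "real \<Rightarrow> real \<Rightarrow> complex" where
  "S x \<alpha> = (\<Sum>n | 0 < n \<and> real n \<le> x. of_nat (tau n) * e (real n * \<alpha>))"

end

theory Submission
  imports Defs "HOL-Number_Theory.Totient"
begin

text \<open>
  Upper bound: by the hyperbola method \<open>S\<close> is, up to \<open>\<surd>x\<close> terms of modulus 1, twice the sum over
  \<open>m \<le> \<surd>x\<close> of the sums of \<open>e (m n \<alpha>)\<close> over \<open>m < n \<le> x / m\<close>. Each of these is a Dirichlet kernel evaluated
  at \<open>m \<alpha>\<close>, whose \<open>L\<^sup>1\<close> norm is \<open>O (log x)\<close>.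

  Lower bound: \<open>S\<close> is reproduced by convolution with a de la Vallee-Poussin kernel, and the fractions
  \<open>a / q\<close> with \<open>q \<le> Q \<le> \<surd>x\<close> are \<open>1 / x\<close>-separated, so the sum of the values of \<open>S\<close> at all reduced
  fractions with \<open>q \<le> Q\<close> is at most \<open>O (x)\<close> times the \<open>L\<^sup>1\<close> norm. For fixed \<open>q\<close> the sum \<open>T q\<close> of the values
  at the reduced \<open>a / q\<close> is a Ramanujan-type sum; summing \<open>T d\<close> over the divisors \<open>d\<close> of \<open>q\<close> counts lattice
  points \<open>m n \<le> x\<close> with \<open>q\<close> dividing \<open>m n\<close>. This gives a main term of size about
  \<open>2 \<phi> q x / q\<close> and an error that is \<open>O (\<surd>x Q\<^sup>2)\<close> in total. With \<open>Q\<close> a small multiple of \<open>\<surd>x\<close>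
  the main terms, of total order \<open>x Q\<close>, dominate.
\<close>

subsection \<open>Divisor sums\<close>

text \<open>Writing \<open>q = d * k\<close>, both sides run over the pairs \<open>(d, k)\<close> of
  positive integers with \<open>d * k \<le> Q\<close>.\<close>

lemma sum_divisors_swap:
  fixes f :: "nat \<Rightarrow> nat \<Rightarrow> 'a::comm_monoid_add"
  shows "(\<Sum>q\<in>{1..Q}. \<Sum>d | d dvd q. f d (q div d)) = (\<Sum>k\<in>{1..Q}. \<Sum>d\<in>{1..Q div k}. f d k)"
proof -
  have "(\<Sum>q\<in>{1..Q}. \<Sum>d | d dvd q. f d (q div d))
      = (\<Sum>(q, d)\<in>(SIGMA q:{1..Q}. {d. d dvd q}). f d (q div d))"
    by (subst sum.Sigma) (auto intro: finite_divisors_nat)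
  also have "\<dots> = (\<Sum>(k, d)\<in>(SIGMA k:{1..Q}. {1..Q div k}). f d k)"
  proof (rule sum.reindex_bij_witness[where i = "\<lambda>(k, d). (d * k, d)" and j = "\<lambda>(q, d). (q div d, d)"],
      goal_cases)
    case (2 a)
    then obtain q d where qd: "a = (q, d)" "1 \<le> q" "q \<le> Q" "d dvd q" by auto
    then have "d > 0" "q div d > 0" by (auto intro: dvd_pos_nat simp: dvd_div_eq_0_iff)
    moreover have "q div d \<le> Q" using qd div_le_dividend[of q d] by linarith
    ultimately show ?case using qd by (auto simp: less_eq_div_iff_mult_less_eq)
  next
    case (4 a)
    then show ?case
      by (auto simp: less_eq_div_iff_mult_less_eq)
  qed (auto)
  also have "\<dots> = (\<Sum>k\<in>{1..Q}. \<Sum>d\<in>{1..Q div k}. f d k)"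
    by (subst sum.Sigma) auto
  finally show ?thesis .
qed

text \<open>Dirichlet's hyperbola method: the pairs of positive integers with product at most
  \<open>N\<close> are split into \<open>m < n\<close>, \<open>n < m\<close> and
  \<open>m = n\<close>. Swapping the factors exchanges the first two classes, whence the factor 2;
  the last one gives the squares.\<close>

lemma sum_tau_hyperbola:
  fixes f :: "nat \<Rightarrow> 'a::comm_semiring_1"
  defines "R \<equiv> \<lambda>N. {m. 0 < m \<and> m * m \<le> N}"
  shows "(\<Sum>n\<in>{1..N}. of_nat (tau n) * f n)
    = 2 * (\<Sum>m\<in>R N. \<Sum>n\<in>{m<..N div m}. f (m * n)) + (\<Sum>m\<in>R N. f (m * m))"
proof -
  define P where "P = (SIGMA k:{1..N}. {1..N div k})"
  have P: "(m, n) \<in> P \<longleftrightarrow> 0 < m \<and> 0 < n \<and> m * n \<le> N" for m n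
    unfolding P_def
    by (auto simp: less_eq_div_iff_mult_less_eq mult.commute Suc_le_eq
        intro: order_trans[of m "m * n" N])
  have finP: "finite P" unfolding P_def by auto
  have finR: "finite (R N)"
    unfolding R_def by (rule finite_subset[of _ "{..N}"]) (auto intro: order_trans[OF le_square])
  have "(\<Sum>n\<in>{1..N}. of_nat (tau n) * f n)
      = (\<Sum>n\<in>{1..N}. \<Sum>d | d dvd n. f (d * (n div d)))"
    by (rule sum.cong) (auto simp: tau_def)
  also have "\<dots> = (\<Sum>k\<in>{1..N}. \<Sum>d\<in>{1..N div k}. f (d * k))"
    by (rule sum_divisors_swap[where f = "\<lambda>d k. f (d * k)"])
  also have "\<dots> = (\<Sum>(k, d)\<in>P. f (d * k))"
    unfolding P_def by (subst sum.Sigma) auto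
  also have "P = {(m, n) \<in> P. m < n} \<union> {(m, n) \<in> P. n < m} \<union> {(m, n) \<in> P. m = n}"
    by auto
  also have "(\<Sum>(k, d)\<in>\<dots>. f (d * k)) = (\<Sum>(k, d)\<in>{(m, n) \<in> P. m < n}. f (d * k))
     + (\<Sum>(k, d)\<in>{(m, n) \<in> P. n < m}. f (d * k)) + (\<Sum>(k, d)\<in>{(m, n) \<in> P. m = n}. f (d * k))"
    using finP by (subst sum.union_disjoint, auto intro: finite_subset[of _ P])+
  also have "(\<Sum>(k, d)\<in>{(m, n) \<in> P. n < m}. f (d * k)) = (\<Sum>(k, d)\<in>{(m, n) \<in> P. m < n}. f (d * k))"
    by (rule sum.reindex_bij_witness[where i = "\<lambda>(a, b). (b, a)" and j = "\<lambda>(a, b). (b, a)"])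
       (auto simp: P mult.commute)
  also have "(\<Sum>(k, d)\<in>{(m, n) \<in> P. m = n}. f (d * k)) = (\<Sum>m\<in>R N. f (m * m))"
    by (rule sum.reindex_bij_witness[where i = "\<lambda>a. (a, a)" and j = fst]) (auto simp: P R_def)
  also have "{(m, n) \<in> P. m < n} = (SIGMA m:R N. {m<..N div m})"
  proof -
    \<comment> \<open>The smaller factor lies in \<open>R N\<close> automatically, so restricting
      \<open>m\<close> to \<open>R N\<close> loses no pair.\<close>
    have "m * m \<le> N" if "m * n \<le> N" "m < n" for m n
      using that by (meson less_imp_le mult_le_mono2 order_trans)
    then show ?thesis
      by (auto simp: P R_def less_eq_div_iff_mult_less_eq mult.commute)
  qed
  also have "(\<Sum>(k, d)\<in>\<dots>. f (d * k)) = (\<Sum>m\<in>R N. \<Sum>n\<in>{m<..N div m}. f (m * n))"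
    by (subst sum.Sigma) (auto simp: finR mult.commute)
  finally show ?thesis by (simp add: algebra_simps mult_2)
qed

lemma card_squares_le: "finite {m. 0 < m \<and> m * m \<le> N}"
  "real (card {m. 0 < m \<and> m * m \<le> N}) \<le> sqrt (real N)"
proof -
  have sub: "{m. 0 < m \<and> m * m \<le> N} \<subseteq> {1..nat \<lfloor>sqrt (real N)\<rfloor>}"
  proof safe
    fix m assume m: "0 < m" "m * m \<le> N"
    have "real m ^ 2 \<le> real N"
      using m(2) by (metis of_nat_le_iff of_nat_mult power2_eq_square)
    then have "real m \<le> sqrt (real N)" by (rule real_le_rsqrt)
    then show "m \<in> {1..nat \<lfloor>sqrt (real N)\<rfloor>}" using m by (auto simp: le_nat_floor)
  qed
  then show "finite {m. 0 < m \<and> m * m \<le> N}" by (rule finite_subset) simp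
  have "card {m. 0 < m \<and> m * m \<le> N} \<le> nat \<lfloor>sqrt (real N)\<rfloor>"
    using card_mono[OF _ sub] by simp
  also have "real (nat \<lfloor>sqrt (real N)\<rfloor>) \<le> sqrt (real N)" by simp
  finally show "real (card {m. 0 < m \<and> m * m \<le> N}) \<le> sqrt (real N)" by simp
qed

section \<open>Averages over proper divisors\<close>

lemma sum_inverse_squares_from_2: "(\<Sum>k\<in>{2..n}. 1 / real k ^ 2) \<le> 3 / 4"
proof -
  \<comment> \<open>The extra \<open>- 1 / real n\<close> makes the induction telescope; at
    \<open>n = 2\<close> there is equality.\<close>
  have "(\<Sum>k\<in>{2..n}. 1 / real k ^ 2) \<le> 3 / 4 - 1 / real n" if "n \<ge> 2"
    using that
  proof (induction n rule: dec_induct)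
    case (step n)
    have "1 / real (Suc n) ^ 2 \<le> 1 / (real n * real (Suc n))"
      using step by (intro divide_left_mono) (auto simp: power2_eq_square mult_right_mono)
    also have "\<dots> = 1 / real n - 1 / real (Suc n)"
      using step by (simp add: field_simps)
    finally show ?case using step by simp
  qed simp
  moreover have "3 / 4 - 1 / real n \<le> 3 / 4" by simp
  ultimately show ?thesis by (cases "n \<ge> 2") (blast intro: order_trans, simp)
qed

lemma sum_inverse_squares_from_1: "(\<Sum>k\<in>{1..n}. 1 / real k ^ 2) \<le> 2"
proof (cases "n \<ge> 1")
  case True
  then have "{1..n} = insert 1 {2..n}" by auto
  then show ?thesis using sum_inverse_squares_from_2[of n] by simp
qed simp

lemma sum_proper_divisors_swap:
  fixes f :: "nat \<Rightarrow> nat \<Rightarrow> real"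
  shows "(\<Sum>q\<in>{1..Q}. \<Sum>d | d dvd q \<and> d < q. f d (q div d)) = (\<Sum>k\<in>{2..Q}. \<Sum>d\<in>{1..Q div k}. f d k)"
proof -
  \<comment> \<open>The divisor \<open>d = q\<close> is the one with cofactor 1. Giving it the value
    0 reduces the claim to the swap over all divisors.\<close>
  define g where "g d k = (if k = 1 then 0 else f d k)" for d k :: nat
  have "(\<Sum>d | d dvd q \<and> d < q. f d (q div d)) = (\<Sum>d | d dvd q. g d (q div d))" if "q \<in> {1..Q}" for q
  proof (rule sum.mono_neutral_cong_left)
    show "finite {d. d dvd q}" using that by (auto intro: finite_divisors_nat)
    show "\<forall>d\<in>{d. d dvd q} - {d. d dvd q \<and> d < q}. g d (q div d) = 0"
    proof
      fix d assume "d \<in> {d. d dvd q} - {d. d dvd q \<and> d < q}"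
      then have "d = q" using that by (auto dest: dvd_imp_le)
      then show "g d (q div d) = 0" using that by (auto simp: g_def)
    qed
  qed (use that in \<open>auto simp: g_def dest: dvd_mult_div_cancel\<close>)
  then have "(\<Sum>q\<in>{1..Q}. \<Sum>d | d dvd q \<and> d < q. f d (q div d))
     = (\<Sum>q\<in>{1..Q}. \<Sum>d | d dvd q. g d (q div d))" by simp
  also have "\<dots> = (\<Sum>k\<in>{1..Q}. \<Sum>d\<in>{1..Q div k}. g d k)" by (rule sum_divisors_swap)
  also have "\<dots> = (\<Sum>k\<in>{2..Q}. \<Sum>d\<in>{1..Q div k}. f d k)"
    by (rule sum.mono_neutral_cong_right) (auto simp: g_def not_le)
  finally show ?thesis .
qed

text \<open>A substitute for Moebius inversion. The trivial bound
  \<open>norm (r q) \<le> K * real q + (\<Sum>d | d dvd q \<and> d < q. norm (r d))\<close> loses too much pointwise, but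
  on average it still gives a quadratic bound, because the sum of \<open>1 / k\<^sup>2\<close> over \<open>k \<ge> 2\<close> is less than 1.\<close>

lemma sum_norm_le_of_divisor_sums:
  fixes r :: "nat \<Rightarrow> 'a::real_normed_vector"
  assumes r: "\<And>q. q > 0 \<Longrightarrow> norm (\<Sum>d | d dvd q. r d) \<le> K * real q" and K: "K \<ge> 0"
  shows "(\<Sum>q\<in>{1..Q}. norm (r q)) \<le> 4 * K * real Q ^ 2"
proof (induction Q rule: less_induct)
  case (less Q)
  have rec: "norm (r q) \<le> K * real q + (\<Sum>d | d dvd q \<and> d < q. norm (r d))" if "q > 0" for q
  proof -
    have "{d. d dvd q} = insert q {d. d dvd q \<and> d < q}"
      using that by (auto dest: dvd_imp_le)
    then have "(\<Sum>d | d dvd q. r d) = r q + (\<Sum>d | d dvd q \<and> d < q. r d)"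
      by simp
    then have "norm (r q) \<le> norm (\<Sum>d | d dvd q. r d) + norm (\<Sum>d | d dvd q \<and> d < q. r d)"
      by (metis add_diff_cancel_right' norm_triangle_ineq4)
    also have "norm (\<Sum>d | d dvd q \<and> d < q. r d) \<le> (\<Sum>d | d dvd q \<and> d < q. norm (r d))"
      by (rule norm_sum)
    finally show ?thesis using r[OF that] by linarith
  qed
  have "(\<Sum>q\<in>{1..Q}. norm (r q))
      \<le> (\<Sum>q\<in>{1..Q}. K * real Q + (\<Sum>d | d dvd q \<and> d < q. norm (r d)))"
  proof (rule sum_mono)
    fix q assume "q \<in> {1..Q}"
    then show "norm (r q) \<le> K * real Q + (\<Sum>d | d dvd q \<and> d < q. norm (r d))"
      using rec[of q] mult_left_mono[of "real q" "real Q" K] K by auto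
  qed
  also have "\<dots> = K * real Q ^ 2 + (\<Sum>k\<in>{2..Q}. \<Sum>d\<in>{1..Q div k}. norm (r d))"
    by (simp add: sum.distrib power2_eq_square
        sum_proper_divisors_swap[where f = "\<lambda>d k. norm (r d)", simplified])
  also have "(\<Sum>k\<in>{2..Q}. \<Sum>d\<in>{1..Q div k}. norm (r d))
      \<le> (\<Sum>k\<in>{2..Q}. 4 * K * real Q ^ 2 * (1 / real k ^ 2))"
  proof (rule sum_mono)
    fix k assume k: "k \<in> {2..Q}"
    have "(\<Sum>d\<in>{1..Q div k}. norm (r d)) \<le> 4 * K * real (Q div k) ^ 2"
      using k by (intro less) auto
    also have "\<dots> \<le> 4 * K * (real Q / real k) ^ 2"
      using K by (intro mult_left_mono power_mono) (auto simp: of_nat_div_le_of_nat)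
    finally show "(\<Sum>d\<in>{1..Q div k}. norm (r d)) \<le> 4 * K * real Q ^ 2 * (1 / real k ^ 2)"
      by (simp add: power_divide)
  qed
  \<comment> \<open>The constant 4 closes the induction because
    \<open>1 + 4 * (3 / 4) = 4\<close>.\<close>
  also have "\<dots> \<le> 4 * K * real Q ^ 2 * (3 / 4)"
    unfolding sum_distrib_left[symmetric]
    using K by (intro mult_left_mono sum_inverse_squares_from_2) auto
  finally show ?case by simp
qed

text \<open>The totients of the divisors of \<open>q\<close> add up to \<open>q\<close>. Bounding
  those of the proper divisors \<open>d\<close> by \<open>d\<close> itself loses, after summation
  over \<open>q\<close>, at most \<open>3 / 4\<close> of the total \<open>Q\<close>.\<close>

lemma sum_totient_over_ge: "(\<Sum>q\<in>{1..Q}. real (totient q) / real q) \<ge> real Q / 4"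
proof -
  have ge: "real (totient q) / real q \<ge> 1 - (\<Sum>d | d dvd q \<and> d < q. 1 / real (q div d))"
    if "q > 0" for q
  proof -
    have "{d. d dvd q} = insert q {d. d dvd q \<and> d < q}"
      using that by (auto dest: dvd_imp_le)
    then have "q = totient q + (\<Sum>d | d dvd q \<and> d < q. totient d)"
      using totient_divisor_sum[of q] by simp
    also have "\<dots> \<le> totient q + (\<Sum>d | d dvd q \<and> d < q. d)"
      by (intro add_left_mono sum_mono totient_le)
    finally have "real q \<le> real (totient q + (\<Sum>d | d dvd q \<and> d < q. d))"
      by (rule of_nat_mono)
    then have "real q \<le> real (totient q) + (\<Sum>d | d dvd q \<and> d < q. real d)" by simp
    then have "1 \<le> real (totient q) / real q + (\<Sum>d | d dvd q \<and> d < q. real d / real q)"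
      using that by (simp add: field_simps flip: sum_divide_distrib)
    also have "(\<Sum>d | d dvd q \<and> d < q. real d / real q) = (\<Sum>d | d dvd q \<and> d < q. 1 / real (q div d))"
      using that by (intro sum.cong) (auto simp: real_of_nat_div)
    finally show ?thesis by linarith
  qed
  have "(\<Sum>q\<in>{1..Q}. \<Sum>d | d dvd q \<and> d < q. 1 / real (q div d))
      = (\<Sum>k\<in>{2..Q}. \<Sum>d\<in>{1..Q div k}. 1 / real k)"
    by (rule sum_proper_divisors_swap[where f = "\<lambda>d k. 1 / real k"])
  also have "\<dots> \<le> (\<Sum>k\<in>{2..Q}. real Q * (1 / real k ^ 2))"
  proof (rule sum_mono)
    fix k assume k: "k \<in> {2..Q}"
    have "(\<Sum>d\<in>{1..Q div k}. 1 / real k) = real (Q div k) / real k" by simp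
    also have "\<dots> \<le> (real Q / real k) / real k"
      by (intro divide_right_mono) (auto simp: of_nat_div_le_of_nat)
    finally show "(\<Sum>d\<in>{1..Q div k}. 1 / real k) \<le> real Q * (1 / real k ^ 2)"
      by (simp add: power2_eq_square)
  qed
  also have "\<dots> \<le> real Q * (3 / 4)"
    unfolding sum_distrib_left[symmetric] by (intro mult_left_mono sum_inverse_squares_from_2) auto
  finally have "(\<Sum>q\<in>{1..Q}. \<Sum>d | d dvd q \<and> d < q. 1 / real (q div d)) \<le> real Q * (3 / 4)" .
  moreover have "(\<Sum>q\<in>{1..Q}. 1 - (\<Sum>d | d dvd q \<and> d < q. 1 / real (q div d)))
      \<le> (\<Sum>q\<in>{1..Q}. real (totient q) / real q)"
    by (intro sum_mono ge) auto
  ultimately show ?thesis by (simp add: sum_subtractf)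
qed

section \<open>Counting multiples in an interval\<close>

lemma card_multiples_greaterThanAtMost:
  fixes a b k :: nat
  assumes "k > 0" "a \<le> b"
  shows "card {n\<in>{a<..b}. k dvd n} = b div k - a div k"
proof -
  have "{n\<in>{a<..b}. k dvd n} = (\<lambda>j. k * j) ` {a div k<..b div k}"
  proof safe
    fix n assume n: "n \<in> {a<..b}" "k dvd n"
    then obtain j where j: "n = k * j" by (elim dvdE)
    have "a div k < j" "j \<le> b div k"
      using n(1) assms(1) unfolding j
      by (auto simp: less_eq_div_iff_mult_less_eq div_less_iff_less_mult mult.commute)
    then show "n \<in> (\<lambda>j. k * j) ` {a div k<..b div k}" using j by auto
  qed (use assms in \<open>auto simp: less_eq_div_iff_mult_less_eq div_less_iff_less_mult mult.commute\<close>)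
  then show ?thesis using assms by (simp add: card_image inj_on_def)
qed

text \<open>With \<open>g = gcd q m\<close> and \<open>k = q div g\<close>, \<open>q\<close> divides
  \<open>m * n\<close> iff \<open>k\<close> divides \<open>n\<close>. The error is exactly
  \<open>g\<close> times a difference of two residues modulo \<open>k\<close>, hence at most
  \<open>g * k = q\<close>.\<close>

lemma card_dvd_mult_approx:
  fixes a b m q :: nat
  assumes "q > 0" "a \<le> b"
  shows "\<bar>real q * real (card {n\<in>{a<..b}. q dvd m * n}) - real (card {a<..b}) * real (gcd q m)\<bar> \<le> real q"
proof -
  define g where "g = gcd q m"
  define k where "k = q div g"
  have g: "g > 0" "g dvd q" "g dvd m" using assms by (auto simp: g_def)
  have q: "q = g * k" using g by (simp add: k_def)
  have k: "k > 0" using q assms by auto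
  have cop: "coprime k (m div g)"
    unfolding k_def g_def using assms by (intro div_gcd_coprime) auto
  have "q dvd m * n \<longleftrightarrow> k dvd n" for n
  proof -
    have "m * n = g * ((m div g) * n)" using g by (simp flip: mult.assoc)
    then have "q dvd m * n \<longleftrightarrow> g * k dvd g * ((m div g) * n)" by (simp only: q)
    then have "q dvd m * n \<longleftrightarrow> k dvd (m div g) * n" using g by simp
    then show ?thesis using cop by (simp add: coprime_dvd_mult_right_iff)
  qed
  then have "card {n\<in>{a<..b}. q dvd m * n} = b div k - a div k"
    using card_multiples_greaterThanAtMost[OF k assms(2)] by simp
  moreover have "a div k \<le> b div k" using assms(2) by (rule div_le_mono)
  ultimately have card: "real (card {n\<in>{a<..b}. q dvd m * n}) = real (b div k) - real (a div k)"
    by simp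
  have dm: "real b = real k * real (b div k) + real (b mod k)" "real a = real k * real (a div k) + real (a mod k)"
    by (simp_all flip: of_nat_mult of_nat_add)
  have "real q * real (card {n\<in>{a<..b}. q dvd m * n}) - real (card {a<..b}) * real (gcd q m)
     = real g * (real (a mod k) - real (b mod k))"
    unfolding card unfolding g_def[symmetric] using assms dm by (simp add: q algebra_simps)
  moreover have "\<bar>real (a mod k) - real (b mod k)\<bar> \<le> real k"
    using mod_less_divisor[OF k, of a] mod_less_divisor[OF k, of b] by linarith
  ultimately show ?thesis by (simp add: abs_mult q mult_left_mono)
qed

subsection \<open>The Dirichlet kernel\<close>

lemma e_eq_cis: "e \<alpha> = cis (2 * pi * \<alpha>)"
  by (simp add: e_def cis_conv_exp mult_ac)

lemma e_add: "e (a + b) = e a * e b"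
  by (simp add: e_eq_cis cis_mult algebra_simps)

lemma e_0 [simp]: "e 0 = 1" and norm_e [simp]: "norm (e a) = 1"
  by (simp_all add: e_eq_cis)

lemma e_of_int [simp]: "e (real_of_int k) = 1"
  by (simp add: e_eq_cis complex_eq_iff)

lemma e_of_nat [simp]: "e (real k) = 1"
  using e_of_int[of "int k"] by simp

lemma e_mult_of_nat: "e (real n * a) = e a ^ n"
  by (simp add: e_eq_cis Complex.DeMoivre mult.left_commute)

lemma continuous_on_e [continuous_intros]:
  "continuous_on A f \<Longrightarrow> continuous_on A (\<lambda>x. e (f x))"
  unfolding e_def by (intro continuous_intros)

lemma norm_one_minus_e: "norm (1 - e a) = 2 * \<bar>sin (pi * a)\<bar>"
proof -
  have "norm (1 - e a) = norm (1 - exp (\<i> * complex_of_real (2 * pi * a)))"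
    by (simp add: e_def mult_ac)
  also have "\<dots> = 2 * \<bar>sin (pi * a)\<bar>"
    by (metis dist_exp_i_1 dist_norm norm_minus_commute mult.assoc mult_2 add_divide_distrib field_sum_of_halves distrib_left)
  finally show ?thesis .
qed

lemma sin_ge_half:
  assumes "0 \<le> x" "x \<le> pi / 2"
  shows "sin x \<ge> x / 2"
proof -
  have "\<bar>sin x - x\<bar> \<le> x ^ 3 / 6"
    using Maclaurin_sin_bound[of x 3] assms
    by (simp add: sin_coeff_def numeral_3_eq_3 fact_numeral)
  moreover have "x ^ 3 / 6 \<le> x / 2"
  proof -
    \<comment> \<open>Any bound between \<open>pi / 2\<close> and the square root of 3 serves here,
      since \<open>x ^ 3 / 6 \<le> x / 2\<close> amounts to \<open>x * x \<le> 3\<close>.\<close>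
    have "x \<le> 1.7" using assms pi_approx by (simp add: field_simps)
    then have "x * x \<le> 1.7 * 1.7" using assms by (intro mult_mono) auto
    then have "x * (x * x) \<le> x * 3" using assms by (intro mult_left_mono) auto
    then show ?thesis by (simp add: power3_eq_cube)
  qed
  ultimately show ?thesis by linarith
qed

text \<open>A one-sided Dirichlet kernel. Since its frequencies start at 0, the sum over any block
  of consecutive frequencies is such a kernel times a factor of modulus 1.\<close>

definition dirichlet :: "nat \<Rightarrow> real \<Rightarrow> complex" where
  "dirichlet K a = (\<Sum>j<K. e (real j * a))"

lemma continuous_on_dirichlet [continuous_intros]:
  "continuous_on A f \<Longrightarrow> continuous_on A (\<lambda>x. dirichlet K (f x))"
  unfolding dirichlet_def by (intro continuous_intros)

lemma e_periodic: "e (a + real_of_int k) = e a"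
  by (simp add: e_add)

lemma dirichlet_periodic: "dirichlet K (a + real_of_int k) = dirichlet K a"
proof -
  have "e (real j * (a + real_of_int k)) = e (real j * a)" for j
    using e_periodic[of "real j * a" "int j * k"] by (simp add: algebra_simps)
  then show ?thesis by (simp add: dirichlet_def)
qed

lemma norm_dirichlet_le: "norm (dirichlet K a) \<le> real K"
  unfolding dirichlet_def by (rule order_trans[OF norm_sum]) simp

lemma dirichlet_mult: "dirichlet K a * (1 - e a) = 1 - e a ^ K"
  unfolding dirichlet_def e_mult_of_nat
  using one_diff_power_eq[of "e a" K] by (simp add: mult.commute)

lemma norm_dirichlet_le_sin: "norm (dirichlet K a) * \<bar>sin (pi * a)\<bar> \<le> 1"
proof -
  have "norm (dirichlet K a) * norm (1 - e a) = norm (1 - e a ^ K)"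
    by (metis dirichlet_mult norm_mult)
  also have "\<dots> \<le> norm (1::complex) + norm (e a ^ K)" by (rule norm_triangle_ineq4)
  finally show ?thesis by (simp add: norm_one_minus_e norm_power)
qed

text \<open>The maximum is the reciprocal of the distance \<open>b\<close> from \<open>a\<close> to
  the nearest integer, and \<open>\<bar>sin (pi * a)\<bar> = sin (pi * b)\<close> is at least
  \<open>pi * b / 2\<close>, hence at least \<open>b\<close>.\<close>

lemma norm_dirichlet_le_inverse:
  assumes "0 < a" "a < 1"
  shows "norm (dirichlet K a) \<le> max (1 / a) (1 / (1 - a))"
proof -
  have key: "norm (dirichlet K a) \<le> 1 / b"
    if b: "0 < b" "b \<le> 1 / 2" "\<bar>sin (pi * a)\<bar> = sin (pi * b)" for b
  proof -
    have "pi * b / 2 \<le> sin (pi * b)" using b by (intro sin_ge_half) auto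
    moreover have "b \<le> pi * b / 2" using b pi_approx by simp
    ultimately have "b \<le> \<bar>sin (pi * a)\<bar>" using b by linarith
    then have "norm (dirichlet K a) * b \<le> norm (dirichlet K a) * \<bar>sin (pi * a)\<bar>"
      using b by (intro mult_left_mono) auto
    also have "\<dots> \<le> 1" by (rule norm_dirichlet_le_sin)
    finally show ?thesis using b by (simp add: field_simps)
  qed
  have pos: "sin (pi * a) > 0" using assms by (intro sin_gt_zero) auto
  show ?thesis
  proof (cases "a \<le> 1 / 2")
    case True
    then show ?thesis using key[of a] assms pos by simp
  next
    case False
    have "sin (pi * (1 - a)) = sin (pi * a)" by (simp add: right_diff_distrib)
    then show ?thesis using key[of "1 - a"] assms pos False by simp
  qed
qed

text \<open>Replaces the minimum of \<open>K\<close> and \<open>1 / b\<close>, where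
  \<open>b\<close> is the distance to an endpoint, by a continuous majorant with an elementary
  antiderivative, a logarithm.\<close>

lemma norm_dirichlet_le_majorant:
  assumes "0 \<le> a" "a \<le> 1"
  shows "norm (dirichlet K a) \<le> 2 * (real K / (1 + real K * a)) + 2 * (real K / (1 + real K * (1 - a)))"
proof -
  have key: "min (real K) (1 / b) \<le> 2 * (real K / (1 + real K * b))" if "b > 0" for b
  proof (cases "real K * b \<le> 1")
    case True
    then have "real K * (1 + real K * b) \<le> real K * 2" by (intro mult_left_mono) auto
    then have "real K \<le> 2 * (real K / (1 + real K * b))"
      using that by (simp add: field_simps add_pos_nonneg)
    then show ?thesis by linarith
  next
    case False
    then have "1 / b \<le> 2 * (real K / (1 + real K * b))"
      using that by (simp add: field_simps add_pos_nonneg)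
    then show ?thesis by linarith
  qed
  have nn: "0 \<le> 2 * (real K / (1 + real K * b))" if "b \<ge> 0" for b using that by simp
  have *: "norm (dirichlet K a) \<le> real K" by (rule norm_dirichlet_le)
  consider "a = 0" | "a = 1" | "0 < a" "a < 1" using assms by linarith
  then show ?thesis
  proof cases
    case 3
    then have "norm (dirichlet K a) \<le> max (min (real K) (1 / a)) (min (real K) (1 / (1 - a)))"
      using * norm_dirichlet_le_inverse[OF 3, of K] by linarith
    also have "\<dots> \<le> max (2 * (real K / (1 + real K * a))) (2 * (real K / (1 + real K * (1 - a))))"
      using 3 by (intro max.mono key) auto
    finally show ?thesis using nn[of a] nn[of "1 - a"] 3 by linarith
  next
    case 1
    have "0 \<le> 2 * (real K / (1 + real K))" using nn[of 1] by simp
    with * have "norm (dirichlet K a) \<le> 2 * real K + 2 * (real K / (1 + real K))" by linarith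
    then show ?thesis using 1 by (simp add: add.commute)
  next
    case 2
    have "0 \<le> 2 * (real K / (1 + real K))" using nn[of 1] by simp
    with * have "norm (dirichlet K a) \<le> 2 * real K + 2 * (real K / (1 + real K))" by linarith
    then show ?thesis using 2 by (simp add: add.commute)
  qed
qed

lemma integral_norm_dirichlet_le: "integral {0..1} (\<lambda>a. norm (dirichlet K a)) \<le> 4 * ln (1 + real K)"
proof -
  let ?g = "\<lambda>a. 2 * (real K / (1 + real K * a)) + 2 * (real K / (1 + real K * (1 - a)))"
  let ?F = "\<lambda>a. 2 * ln (1 + real K * a) - 2 * ln (1 + real K * (1 - a))"
  have "(?g has_integral (?F 1 - ?F 0)) {0..1}"
  proof (rule fundamental_theorem_of_calculus)
    fix x :: real assume x: "x \<in> {0..1}"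
    then have "1 + real K * x > 0" "1 + real K * (1 - x) > 0" by (auto intro!: add_pos_nonneg)
    then have "(?F has_real_derivative ?g x) (at x within {0..1})"
      by (auto intro!: derivative_eq_intros simp: mult.commute)
    then show "(?F has_vector_derivative ?g x) (at x within {0..1})"
      by (simp add: has_real_derivative_iff_has_vector_derivative)
  qed simp
  then have g: "(?g has_integral 4 * ln (1 + real K)) {0..1}" by simp
  have "integral {0..1} (\<lambda>a. norm (dirichlet K a)) \<le> integral {0..1} ?g"
    by (intro integral_le integrable_continuous_real continuous_intros norm_dirichlet_le_majorant
        has_integral_integrable[OF g]) auto
  also have "\<dots> = 4 * ln (1 + real K)" using g by (rule integral_unique)
  finally show ?thesis .
qed

text \<open>The dilation runs through \<open>m\<close> full periods at speed \<open>m\<close>. Hence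
  replacing \<alpha> by \<open>m * \<alpha>\<close> leaves the \<open>L^1\<close> norm of a
  Dirichlet kernel unchanged.\<close>

lemma integral_periodic_stretch:
  fixes f :: "real \<Rightarrow> real"
  assumes per: "\<And>a k. f (a + real_of_int k) = f a" and cont: "continuous_on UNIV f" and m: "m > 0"
  shows "integral {0..1} (\<lambda>a. f (real m * a)) = integral {0..1} f"
proof -
  have int: "f integrable_on {a..b}" for a b
    using cont by (intro integrable_continuous_real) (auto intro: continuous_on_subset)
  have shift: "(f has_integral integral {0..1} f) {real j..real j + 1}" for j :: nat
  proof -
    have "((\<lambda>x. f (1 *\<^sub>R x + - real j)) has_integral integral {0..1} f /\<^sub>R \<bar>1\<bar>) ((\<lambda>x. (1 / 1) *\<^sub>R x + - ((1/1) *\<^sub>R - real j)) ` cbox 0 1)"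
      using has_integral_affinity[of f "integral {0..1} f" 0 1 1 "- real j"] int[of 0 1]
      by (simp add: has_integral_integral[symmetric] cbox_interval)
    moreover have "f (x - real j) = f x" for x using per[of x "- int j"] by simp
    ultimately show ?thesis by (simp add: add.commute)
  qed
  have sum: "(f has_integral real j * integral {0..1} f) {0..real j}" for j :: nat
  proof (induction j)
    case (Suc j)
    have "(f has_integral (real j * integral {0..1} f + integral {0..1} f)) {0..real j + 1}"
      by (rule has_integral_combine[OF _ _ Suc shift]) auto
    then show ?case by (simp add: algebra_simps)
  qed (simp add: has_integral_refl)
  have "((\<lambda>x. f (real m * x)) has_integral real m * integral {0..1} f / real m) {0..1}"
    using has_integral_stretch_real[of f "real m * integral {0..1} f" 0 "real m" "real m"] sum[of m] m
    by simp
  then show ?thesis using m by (simp add: integral_unique)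
qed

lemma has_integral_e_int:
  "((\<lambda>a. e (real_of_int k * a)) has_integral (if k = 0 then 1 else 0)) {0..1}"
proof (cases "k = 0")
  case True
  then show ?thesis using has_integral_const_real[of "1::complex" 0 1] by simp
next
  case False
  let ?c = "2 * complex_of_real pi * \<i> * of_int k"
  have c: "?c \<noteq> 0" using False by simp
  have "((\<lambda>a. e (real_of_int k * a)) has_integral (e (real_of_int k * 1) / ?c - e (real_of_int k * 0) / ?c)) {0..1}"
  proof (rule fundamental_theorem_of_calculus)
    fix x :: real
    have "((\<lambda>z. exp (?c * z) / ?c) has_field_derivative exp (?c * of_real x)) (at (of_real x))"
      using c by (auto intro!: derivative_eq_intros)
    then have "((\<lambda>a. exp (?c * of_real a) / ?c) has_vector_derivative exp (?c * of_real x)) (at x within {0..1})"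
      by (rule has_vector_derivative_real_field)
    then show "((\<lambda>a. e (real_of_int k * a) / ?c) has_vector_derivative e (real_of_int k * x)) (at x within {0..1})"
      by (simp add: e_def mult_ac)
  qed simp
  then show ?thesis using False by simp
qed

subsection \<open>The upper bound\<close>

lemma S_eq_sum:
  assumes "x \<ge> 0"
  shows "S x \<alpha> = (\<Sum>n\<in>{1..nat \<lfloor>x\<rfloor>}. of_nat (tau n) * e (real n * \<alpha>))"
proof -
  have "{n. 0 < n \<and> real n \<le> x} = {1..nat \<lfloor>x\<rfloor>}"
    using assms by (auto simp: le_nat_floor Suc_le_eq) (metis floor_of_nat nat_le_iff of_nat_floor of_nat_mono order_trans)
  then show ?thesis by (simp add: S_def)
qed

lemma sum_e_greaterThanAtMost:
  "(\<Sum>n\<in>{a<..b}. e (real n * \<beta>)) = e (real (Suc a) * \<beta>) * dirichlet (b - a) \<beta>"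
proof -
  have "(\<Sum>n\<in>{a<..b}. e (real n * \<beta>)) = (\<Sum>j<b - a. e (real (Suc a + j) * \<beta>))"
    by (rule sum.reindex_bij_witness[where i = "\<lambda>j. Suc a + j" and j = "\<lambda>n. n - Suc a"]) auto
  also have "\<dots> = e (real (Suc a) * \<beta>) * dirichlet (b - a) \<beta>"
    unfolding dirichlet_def sum_distrib_left
    by (intro sum.cong refl) (simp only: of_nat_add distrib_right e_add)
  finally show ?thesis .
qed

lemma integral_norm_S_le:
  assumes "x \<ge> 2"
  shows "integral {0..1} (\<lambda>\<alpha>. norm (S x \<alpha>)) \<le> 18 * sqrt x * ln x"
proof -
  define N where "N = nat \<lfloor>x\<rfloor>"
  define R where "R = {m. 0 < m \<and> m * m \<le> N}"
  have N: "real N \<le> x" using assms by (simp add: N_def)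
  have R: "finite R" "real (card R) \<le> sqrt x"
    using card_squares_le[of N] order_trans[OF _ real_sqrt_le_mono[OF N]] by (auto simp: R_def)
  define G where "G \<alpha> = 2 * (\<Sum>m\<in>R. norm (dirichlet (N div m - m) (real m * \<alpha>))) + real (card R)" for \<alpha>
  have le: "norm (S x \<alpha>) \<le> G \<alpha>" for \<alpha>
  proof -
    have "S x \<alpha> = 2 * (\<Sum>m\<in>R. \<Sum>n\<in>{m<..N div m}. e (real (m * n) * \<alpha>)) + (\<Sum>m\<in>R. e (real (m * m) * \<alpha>))"
      unfolding R_def using S_eq_sum[of x \<alpha>] assms sum_tau_hyperbola[of "\<lambda>n. e (real n * \<alpha>)" N]
      by (simp add: N_def)
    also have "norm \<dots> \<le> norm (2 * (\<Sum>m\<in>R. \<Sum>n\<in>{m<..N div m}. e (real (m * n) * \<alpha>))) + norm (\<Sum>m\<in>R. e (real (m * m) * \<alpha>))"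
      by (rule norm_triangle_ineq)
    also have "norm (\<Sum>m\<in>R. e (real (m * m) * \<alpha>)) \<le> (\<Sum>m\<in>R. 1)"
      by (rule sum_norm_le) simp
    also have "norm (2 * (\<Sum>m\<in>R. \<Sum>n\<in>{m<..N div m}. e (real (m * n) * \<alpha>)))
        \<le> 2 * (\<Sum>m\<in>R. norm (dirichlet (N div m - m) (real m * \<alpha>)))"
    proof -
      have "norm (\<Sum>m\<in>R. \<Sum>n\<in>{m<..N div m}. e (real (m * n) * \<alpha>))
        \<le> (\<Sum>m\<in>R. norm (dirichlet (N div m - m) (real m * \<alpha>)))"
      proof (rule sum_norm_le)
        fix m
        have "(\<Sum>n\<in>{m<..N div m}. e (real (m * n) * \<alpha>)) = (\<Sum>n\<in>{m<..N div m}. e (real n * (real m * \<alpha>)))"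
          by (simp add: mult_ac)
        then show "norm (\<Sum>n\<in>{m<..N div m}. e (real (m * n) * \<alpha>)) \<le> norm (dirichlet (N div m - m) (real m * \<alpha>))"
          by (simp only: sum_e_greaterThanAtMost norm_mult norm_e)
      qed
      then show ?thesis by (simp add: norm_mult)
    qed
    finally show ?thesis by (simp add: G_def)
  qed
  \<comment> \<open>For \<open>x \<ge> 2\<close> one has \<open>1 + x \<le> x * x\<close>; this
    turns each kernel bound \<open>4 * ln (1 + N)\<close> into \<open>8 * ln x\<close>.\<close>
  have ln: "ln (1 + real N) \<le> 2 * ln x"
  proof -
    have "1 + real N \<le> x * x"
      using N assms mult_right_mono[of 2 x x] by linarith
    then have "ln (1 + real N) \<le> ln (x * x)" using assms by (intro ln_mono) auto
    then show ?thesis using assms by (simp add: ln_mult)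
  qed
  have dir: "integral {0..1} (\<lambda>\<alpha>. norm (dirichlet (N div m - m) (real m * \<alpha>))) \<le> 8 * ln x" if "m \<in> R" for m
  proof -
    have "integral {0..1} (\<lambda>\<alpha>. norm (dirichlet (N div m - m) (real m * \<alpha>)))
        = integral {0..1} (\<lambda>\<alpha>. norm (dirichlet (N div m - m) \<alpha>))"
      using that
      by (intro integral_periodic_stretch[where f = "\<lambda>a. norm (dirichlet (N div m - m) a)"])
         (auto simp: dirichlet_periodic R_def intro!: continuous_intros)
    also have "\<dots> \<le> 4 * ln (1 + real (N div m - m))" by (rule integral_norm_dirichlet_le)
    also have "N div m - m \<le> N" using div_le_dividend[of N m] by linarith
    then have "4 * ln (1 + real (N div m - m)) \<le> 4 * ln (1 + real N)" by simp
    finally show ?thesis using ln by linarith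
  qed
  have int: "(\<lambda>\<alpha>. norm (dirichlet K (real m * \<alpha>))) integrable_on {0..1}" for K m
    by (intro integrable_continuous_real continuous_intros)
  have "integral {0..1} (\<lambda>\<alpha>. norm (S x \<alpha>)) \<le> integral {0..1} G"
    using le unfolding G_def S_def
    by (intro integral_le integrable_continuous_real continuous_intros) auto
  also have "integral {0..1} G = 2 * (\<Sum>m\<in>R. integral {0..1} (\<lambda>\<alpha>. norm (dirichlet (N div m - m) (real m * \<alpha>)))) + real (card R)"
    unfolding G_def using R int
    by (subst integral_add) (auto intro!: integrable_sum integrable_on_mult_right simp: integral_sum)
  also have "\<dots> \<le> 2 * (\<Sum>m\<in>R. 8 * ln x) + real (card R)"
    by (intro add_right_mono mult_left_mono sum_mono dir) auto
  also have "\<dots> = real (card R) * (16 * ln x + 1)" by (simp add: algebra_simps)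
  also have "\<dots> \<le> sqrt x * (16 * ln x + 1)"
    using R assms by (intro mult_right_mono) (auto simp: add_nonneg_nonneg)
  \<comment> \<open>The 1 stemming from the diagonal is absorbed by \<open>2 * ln x\<close>, which
    is at least \<open>2 * ln 2 > 1\<close>.\<close>
  also have "\<dots> \<le> sqrt x * (18 * ln x)"
  proof -
    have "ln 2 \<le> ln x" using assms by simp
    then have "16 * ln x + 1 \<le> 18 * ln x" using ln2_ge_two_thirds by linarith
    then show ?thesis using assms by (intro mult_left_mono) auto
  qed
  finally show ?thesis by (simp add: mult_ac)
qed

subsection \<open>Sums over Farey fractions\<close>

text \<open>A de la Vallee-Poussin kernel: up to the factor \<open>e ((1 - N) \<gamma>) / N\<close> it is the product of two
  Dirichlet kernels of lengths \<open>N\<close> and \<open>2 N\<close>, so its Fourier coefficients equal 1 on \<open>{0..N}\<close>.\<close>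

definition plateau_kernel :: "nat \<Rightarrow> real \<Rightarrow> complex" where
  "plateau_kernel N \<gamma> = (\<Sum>i<N. \<Sum>j<2 * N. e (real_of_int (int i + int j + 1 - int N) * \<gamma>)) / of_nat N"

lemma continuous_on_plateau_kernel [continuous_intros]:
  "continuous_on A f \<Longrightarrow> continuous_on A (\<lambda>x. plateau_kernel N (f x))"
  unfolding plateau_kernel_def divide_inverse by (intro continuous_intros)

text \<open>Convolution multiplies the coefficient of frequency \<open>n\<close> by
  \<open>1 / N\<close> times the number of pairs \<open>(i, j)\<close> with
  \<open>i + j + 1 - N = n\<close>. For \<open>1 \<le> n \<le> N\<close> each \<open>i < N\<close>
  admits exactly one \<open>j < 2 * N\<close>, so the multiplier is 1.\<close>

lemma has_integral_plateau_kernel: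
  assumes N: "N > 0"
  shows "((\<lambda>\<alpha>. (\<Sum>n\<in>{1..N}. c n * e (real n * \<alpha>)) * plateau_kernel N (\<beta> - \<alpha>))
           has_integral (\<Sum>n\<in>{1..N}. c n * e (real n * \<beta>))) {0..1}"
proof -
  define k where "k i j = int i + int j + 1 - int N" for i j
  have eq: "(\<Sum>n\<in>{1..N}. c n * e (real n * \<alpha>)) * plateau_kernel N (\<beta> - \<alpha>)
    = (\<Sum>n\<in>{1..N}. \<Sum>i<N. \<Sum>j<2 * N. c n * e (of_int (k i j) * \<beta>) / of_nat N * e (of_int (int n - k i j) * \<alpha>))" for \<alpha>
  proof -
    have "e (of_int (int n - k i j) * \<alpha>) * e (of_int (k i j) * \<beta>) = e (real n * \<alpha>) * e (of_int (k i j) * (\<beta> - \<alpha>))" for n i j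
      unfolding e_add[symmetric] by (simp add: algebra_simps)
    then have "c n * e (real n * \<alpha>) * plateau_kernel N (\<beta> - \<alpha>)
      = (\<Sum>i<N. \<Sum>j<2 * N. c n * e (of_int (k i j) * \<beta>) / of_nat N * e (of_int (int n - k i j) * \<alpha>))" for n
      unfolding plateau_kernel_def k_def[symmetric] sum_divide_distrib sum_distrib_left
      by (intro sum.cong refl) (simp add: mult_ac)
    then show ?thesis by (simp only: sum_distrib_right)
  qed
  have "((\<lambda>\<alpha>. \<Sum>n\<in>{1..N}. \<Sum>i<N. \<Sum>j<2 * N. c n * e (of_int (k i j) * \<beta>) / of_nat N * e (of_int (int n - k i j) * \<alpha>))
     has_integral (\<Sum>n\<in>{1..N}. \<Sum>i<N. \<Sum>j<2 * N. c n * e (of_int (k i j) * \<beta>) / of_nat N * (if int n - k i j = 0 then 1 else 0))) {0..1}"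
    by (intro has_integral_sum has_integral_mult_right has_integral_e_int) auto
  also have "(\<Sum>n\<in>{1..N}. \<Sum>i<N. \<Sum>j<2 * N. c n * e (of_int (k i j) * \<beta>) / of_nat N * (if int n - k i j = 0 then 1 else 0))
     = (\<Sum>n\<in>{1..N}. \<Sum>i<N. c n * e (real n * \<beta>) / of_nat N)"
  proof (intro sum.cong refl)
    fix n i assume n: "n \<in> {1..N}" and i: "i \<in> {..<N}"
    have iff: "int n - k i j = 0 \<longleftrightarrow> j = n + N - 1 - i" for j
      using n i by (auto simp: k_def)
    have "(\<Sum>j<2 * N. c n * e (of_int (k i j) * \<beta>) / of_nat N * (if int n - k i j = 0 then 1 else 0))
      = (\<Sum>j<2 * N. if j = n + N - 1 - i then c n * e (real n * \<beta>) / of_nat N else 0)"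
    proof (intro sum.cong refl)
      fix j
      have "k i (n + N - 1 - i) = int n" using iff[of "n + N - 1 - i"] by simp
      then have "real_of_int (k i (n + N - 1 - i)) = real n" by simp
      then show "c n * e (of_int (k i j) * \<beta>) / of_nat N * (if int n - k i j = 0 then 1 else 0)
         = (if j = n + N - 1 - i then c n * e (real n * \<beta>) / of_nat N else 0)"
        unfolding iff by auto
    qed
    also have "\<dots> = c n * e (real n * \<beta>) / of_nat N"
      using n i by (subst sum.delta) auto
    finally show "(\<Sum>j<2 * N. c n * e (of_int (k i j) * \<beta>) / of_nat N * (if int n - k i j = 0 then 1 else 0))
      = c n * e (real n * \<beta>) / of_nat N" .
  qed
  also have "\<dots> = (\<Sum>n\<in>{1..N}. c n * e (real n * \<beta>))"
    using N by simp
  finally show ?thesis unfolding eq .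
qed

lemma dirichlet_add: "dirichlet (M + N) \<gamma> = dirichlet M \<gamma> + e (real M * \<gamma>) * dirichlet N \<gamma>"
  unfolding dirichlet_def by (induction N) (simp_all add: algebra_simps e_add)

text \<open>The kernel of length \<open>2 * N\<close> is \<open>1 + e (N * \<gamma>)\<close> times
  the one of length \<open>N\<close>. So the product of the two kernels is controlled by a square,
  which decays fast enough to be summed over separated points.\<close>

lemma norm_plateau_kernel_le:
  "norm (plateau_kernel N \<gamma>) \<le> 2 / real N * norm (dirichlet N \<gamma>) ^ 2"
proof -
  have "(\<Sum>i<N. \<Sum>j<2 * N. e (real_of_int (int i + int j + 1 - int N) * \<gamma>))
      = e ((1 - real N) * \<gamma>) * (dirichlet N \<gamma> * dirichlet (2 * N) \<gamma>)"
  proof -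
    have "e (real_of_int (int i + int j + 1 - int N) * \<gamma>)
        = e ((1 - real N) * \<gamma>) * (e (real i * \<gamma>) * e (real j * \<gamma>))" for i j
      by (simp add: algebra_simps flip: e_add)
    then show ?thesis by (simp add: dirichlet_def sum_product flip: sum_distrib_left)
  qed
  moreover have "dirichlet (2 * N) \<gamma> = dirichlet N \<gamma> + e (real N * \<gamma>) * dirichlet N \<gamma>"
    by (simp add: mult_2 dirichlet_add)
  moreover have "norm (dirichlet N \<gamma> + e (real N * \<gamma>) * dirichlet N \<gamma>) \<le> 2 * norm (dirichlet N \<gamma>)"
    using norm_triangle_ineq[of "dirichlet N \<gamma>" "e (real N * \<gamma>) * dirichlet N \<gamma>"] by (simp add: norm_mult)
  ultimately have "norm (\<Sum>i<N. \<Sum>j<2 * N. e (real_of_int (int i + int j + 1 - int N) * \<gamma>))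
      \<le> norm (dirichlet N \<gamma>) * (2 * norm (dirichlet N \<gamma>))"
    by (simp add: norm_mult mult_left_mono)
  then show ?thesis
    by (simp add: plateau_kernel_def norm_divide divide_right_mono power2_eq_square mult_ac)
qed

text \<open>Distinct reduced fractions of denominator at most \<open>Q\<close> are at least \<open>1 / Q\<^sup>2\<close> apart modulo 1,
  so their translates fall into different cells of length \<open>1 / Q\<^sup>2\<close>.\<close>

lemma farey_frac_floor_inj:
  fixes \<alpha> :: real
  shows "inj_on (\<lambda>(q, a). nat \<lfloor>frac (real a / real q - \<alpha>) * real (Q ^ 2)\<rfloor>) (SIGMA q:{1..Q}. totatives q)"
proof (rule inj_onI, clarify)
  fix q a q' a' :: nat
  assume q: "q \<in> {1..Q}" "a \<in> totatives q" and q': "q' \<in> {1..Q}" "a' \<in> totatives q'"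
  define P where "P = real (Q ^ 2)"
  define b where "b = frac (real a / real q - \<alpha>)"
  define b' where "b' = frac (real a' / real q' - \<alpha>)"
  assume "nat \<lfloor>frac (real a / real q - \<alpha>) * real (Q ^ 2)\<rfloor> = nat \<lfloor>frac (real a' / real q' - \<alpha>) * real (Q ^ 2)\<rfloor>"
  then have fl: "\<lfloor>b * P\<rfloor> = \<lfloor>b' * P\<rfloor>"
    by (simp add: b_def b'_def P_def eq_nat_nat_iff)
  have P: "P > 0" using q by (simp add: P_def)
  have "\<bar>b * P - b' * P\<bar> < 1" using fl by linarith
  then have lt: "\<bar>b - b'\<bar> * P < 1" using P by (simp add: abs_mult flip: left_diff_distrib)
  define z where "z = \<lfloor>real a' / real q' - \<alpha>\<rfloor> - \<lfloor>real a / real q - \<alpha>\<rfloor>"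
  have bb: "b - b' = real a / real q - real a' / real q' + of_int z"
    by (simp add: b_def b'_def frac_def z_def)
  \<comment> \<open>The numerator of \<open>b - b'\<close> over the denominator
    \<open>q * q'\<close>: an integer of absolute value less than 1, hence 0.\<close>
  define t where "t = int a * int q' - int a' * int q + z * int q * int q'"
  have t: "real_of_int t = (b - b') * (real q * real q')"
    unfolding bb t_def using q q' by (simp add: field_simps)
  have "real q * real q' \<le> P"
    unfolding P_def power2_eq_square of_nat_mult using q q' by (intro mult_mono) auto
  then have "\<bar>b - b'\<bar> * (real q * real q') \<le> \<bar>b - b'\<bar> * P" by (intro mult_left_mono) auto
  then have "\<bar>real_of_int t\<bar> < 1" using lt unfolding t by (simp add: abs_mult)
  then have "t = 0" by linarith
  then have "b - b' = 0" using t q q' by simp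
  then have zeq: "real a / real q - real a' / real q' = - of_int z" using bb by linarith
  \<comment> \<open>Both fractions lie in the half-open unit interval, so they cannot differ by a
    nonzero integer.\<close>
  have "0 < real a / real q" "real a / real q \<le> 1" "0 < real a' / real q'" "real a' / real q' \<le> 1"
    using q q' by (auto simp: in_totatives_iff)
  then have "z = 0" using zeq by linarith
  then have "int (a * q') = int (a' * q)" using \<open>t = 0\<close> by (simp add: t_def)
  then have "a * q' = a' * q" by (simp only: of_nat_eq_iff)
  moreover have "coprime a q" "coprime a' q'" using q q' by (auto simp: in_totatives_iff)
  ultimately show "q = q' \<and> a = a'"
    using coprime_crossproduct_nat[of a q a' q'] by auto
qed

text \<open>The unit circle is cut into \<open>P = Q ^ 2\<close> cells, each holding at most one
  translated fraction. The decay of the kernel bounds the term in cell \<open>k\<close> by a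
  function of the distances to the two ends, and these bounds are summable.\<close>

lemma sum_farey_dirichlet_le:
  assumes Q: "Q \<ge> 1" "Q ^ 2 \<le> N"
  shows "(\<Sum>(q, a)\<in>(SIGMA q:{1..Q}. totatives q). norm (dirichlet N (real a / real q - \<alpha>)) ^ 2) \<le> 6 * real N ^ 2"
proof -
  define P where "P = Q ^ 2"
  define F where "F = (SIGMA q:{1..Q}. totatives q)"
  define \<kappa> where "\<kappa> = (\<lambda>(q, a). nat \<lfloor>frac (real a / real q - \<alpha>) * real P\<rfloor>)"
  \<comment> \<open>\<open>k\<close> counts the full cells between the point and an end of the unit
    interval. For \<open>k = 0\<close> only the trivial bound \<open>N\<close> for the kernel is
    available. The total is at most \<open>N ^ 2 + 2 * P ^ 2 \<le> 3 * N ^ 2\<close>, and the two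
    ends give the constant 6.\<close>
  define h where "h k = (if k = 0 then real N ^ 2 else real P ^ 2 * (1 / real k ^ 2))" for k :: nat
  have P: "P > 0" "real P \<le> real N" using Q by (auto simp: P_def)
  have inj: "inj_on \<kappa> F" using farey_frac_floor_inj[of \<alpha> Q] by (simp add: \<kappa>_def F_def P_def)
  have h0: "h k \<ge> 0" for k by (simp add: h_def)
  have bound: "\<kappa> (q, a) < P \<and> norm (dirichlet N (real a / real q - \<alpha>)) ^ 2 \<le> h (\<kappa> (q, a)) + h (P - Suc (\<kappa> (q, a)))" for q a
  proof -
    define b where "b = frac (real a / real q - \<alpha>)"
    define k where "k = \<kappa> (q, a)"
    have b: "0 \<le> b" "b < 1" by (auto simp: b_def frac_lt_1)
    have "dirichlet N (real a / real q - \<alpha>) = dirichlet N b"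
      using dirichlet_periodic[of N b "\<lfloor>real a / real q - \<alpha>\<rfloor>"] by (simp add: b_def frac_def)
    moreover have k1: "real k \<le> b * real P" "b * real P < real k + 1"
      using b by (auto simp: k_def \<kappa>_def b_def[symmetric])
    have "b * real P < real P" using b P by simp
    then have kP: "k < P" using k1 by linarith
    moreover have "norm (dirichlet N b) ^ 2 \<le> h k + h (P - Suc k)"
    proof (cases "k = 0 \<or> P - Suc k = 0")
      case True
      have "norm (dirichlet N b) ^ 2 \<le> real N ^ 2" by (intro power_mono norm_dirichlet_le) auto
      also have "\<dots> \<le> h k + h (P - Suc k)" using True h0[of k] h0[of "P - Suc k"] by (auto simp: h_def)
      finally show ?thesis .
    next
      case False
      define l where "l = P - Suc k"
      have l: "l > 0" "real l = real P - 1 - real k" using False kP by (auto simp: l_def)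
      have k: "k > 0" using False by simp
      have b0: "0 < b" using k k1 P b by (cases "b = 0") auto
      have le1: "1 / b \<le> real P / real k" using k1 k b0 by (simp add: field_simps)
      have "real l \<le> (1 - b) * real P" using l k1 by (simp add: algebra_simps)
      then have le2: "1 / (1 - b) \<le> real P / real l" using l b by (simp add: field_simps)
      have "norm (dirichlet N b) \<le> max (1 / b) (1 / (1 - b))"
        using b0 b(2) by (rule norm_dirichlet_le_inverse)
      also have "\<dots> \<le> max (real P / real k) (real P / real l)" using le1 le2 by (rule max.mono)
      finally have "norm (dirichlet N b) ^ 2 \<le> max (real P / real k) (real P / real l) ^ 2"
        by (intro power_mono) auto
      also have "\<dots> \<le> (real P / real k) ^ 2 + (real P / real l) ^ 2" by (simp add: max_def)
      also have "\<dots> = h k + h l" using k l by (simp add: h_def power_divide)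
      finally show ?thesis by (simp add: l_def)
    qed
    ultimately show ?thesis by (simp add: k_def)
  qed
  have sumh: "(\<Sum>k<P. h k) \<le> 3 * real N ^ 2"
  proof -
    have "{..<P} = insert 0 {1..P - 1}" using P by auto
    then have "(\<Sum>k<P. h k) = h 0 + (\<Sum>k\<in>{1..P - 1}. h k)" by simp
    also have "(\<Sum>k\<in>{1..P - 1}. h k) = real P ^ 2 * (\<Sum>k\<in>{1..P - 1}. 1 / real k ^ 2)"
      unfolding sum_distrib_left by (intro sum.cong) (auto simp: h_def)
    also have "\<dots> \<le> real N ^ 2 * 2"
      using P by (intro mult_mono sum_inverse_squares_from_1 power_mono) (auto intro: sum_nonneg)
    finally show ?thesis by (simp add: h_def)
  qed
  have "(\<Sum>(q, a)\<in>F. norm (dirichlet N (real a / real q - \<alpha>)) ^ 2) \<le> (\<Sum>r\<in>F. h (\<kappa> r) + h (P - Suc (\<kappa> r)))"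
    using bound by (intro sum_mono) auto
  also have "\<dots> = (\<Sum>k\<in>\<kappa> ` F. h k + h (P - Suc k))"
    by (simp add: sum.reindex[OF inj])
  also have "\<dots> \<le> (\<Sum>k<P. h k + h (P - Suc k))"
    using bound h0 by (intro sum_mono2) auto
  also have "\<dots> = (\<Sum>k<P. h k) + (\<Sum>k<P. h k)"
    by (simp add: sum.distrib sum.nat_diff_reindex)
  finally show ?thesis using sumh by (simp add: F_def)
qed

text \<open>Each value of \<open>s N\<close> is an integral of \<open>s N\<close> against a
  translated plateau kernel. The sum of all these translates is bounded uniformly by
  \<open>2 / N * (6 * N ^ 2) = 12 * N\<close>.\<close>

lemma norm_farey_sum_le_integral:
  fixes c :: "nat \<Rightarrow> complex"
  defines "s \<equiv> \<lambda>N \<alpha>. (\<Sum>n\<in>{1..N}. c n * e (real n * \<alpha>))"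
  assumes Q: "Q \<ge> 1" "Q ^ 2 \<le> N"
  shows "norm (\<Sum>q\<in>{1..Q}. \<Sum>a\<in>totatives q. s N (real a / real q)) \<le> 12 * real N * integral {0..1} (\<lambda>\<alpha>. norm (s N \<alpha>))"
proof -
  have "Q ^ 2 > 0" using Q by simp
  then have N: "N > 0" using Q by linarith
  define F where "F = (SIGMA q:{1..Q}. totatives q)"
  have fin: "finite F" by (auto simp: F_def)
  define G where "G \<alpha> = (\<Sum>r\<in>F. plateau_kernel N (real (snd r) / real (fst r) - \<alpha>))" for \<alpha>
  have G: "norm (G \<alpha>) \<le> 12 * real N" for \<alpha>
  proof -
    have "norm (G \<alpha>) \<le> (\<Sum>r\<in>F. 2 / real N * norm (dirichlet N (real (snd r) / real (fst r) - \<alpha>)) ^ 2)"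
      unfolding G_def by (intro sum_norm_le norm_plateau_kernel_le)
    also have "\<dots> \<le> 2 / real N * (6 * real N ^ 2)"
      unfolding sum_distrib_left[symmetric] F_def using sum_farey_dirichlet_le[OF Q, of \<alpha>]
      by (intro mult_left_mono) (simp_all add: case_prod_unfold)
    also have "\<dots> = 12 * real N" using N by (simp add: power2_eq_square)
    finally show ?thesis .
  qed
  have cont: "continuous_on {0..1} (\<lambda>\<alpha>. s N \<alpha>)" unfolding s_def by (intro continuous_intros)
  have "((\<lambda>\<alpha>. s N \<alpha> * G \<alpha>) has_integral (\<Sum>r\<in>F. s N (real (snd r) / real (fst r)))) {0..1}"
    unfolding G_def sum_distrib_left s_def using fin N
    by (intro has_integral_sum has_integral_plateau_kernel)
  then have "(\<Sum>r\<in>F. s N (real (snd r) / real (fst r))) = integral {0..1} (\<lambda>\<alpha>. s N \<alpha> * G \<alpha>)"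
    by (simp add: integral_unique)
  also have "norm \<dots> \<le> integral {0..1} (\<lambda>\<alpha>. 12 * real N * norm (s N \<alpha>))"
  proof (rule integral_norm_bound_integral)
    show "(\<lambda>\<alpha>. s N \<alpha> * G \<alpha>) integrable_on {0..1}"
      unfolding G_def by (intro integrable_continuous_real continuous_intros cont)
    show "(\<lambda>\<alpha>. 12 * real N * norm (s N \<alpha>)) integrable_on {0..1}"
      by (intro integrable_continuous_real continuous_intros cont)
    show "norm (s N \<alpha> * G \<alpha>) \<le> 12 * real N * norm (s N \<alpha>)" for \<alpha>
      using mult_right_mono[OF G[of \<alpha>], of "norm (s N \<alpha>)"] by (simp add: norm_mult mult.commute)
  qed
  also have "\<dots> = 12 * real N * integral {0..1} (\<lambda>\<alpha>. norm (s N \<alpha>))" by simp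
  also have "(\<Sum>r\<in>F. s N (real (snd r) / real (fst r))) = (\<Sum>q\<in>{1..Q}. \<Sum>a\<in>totatives q. s N (real a / real q))"
    unfolding F_def by (subst sum.Sigma) (auto simp: case_prod_unfold)
  finally show ?thesis .
qed

subsection \<open>The lower bound\<close>

text \<open>Reducing \<open>k / q\<close> to lowest terms gives each \<open>a / d\<close> with
  \<open>d\<close> dividing \<open>q\<close> exactly once; the fractions are grouped by
  \<open>g = gcd k q\<close>, with \<open>d = q div g\<close>.\<close>

lemma sum_totatives_divisors:
  fixes f :: "real \<Rightarrow> 'a::comm_monoid_add"
  assumes q: "q > 0"
  shows "(\<Sum>d | d dvd q. \<Sum>a\<in>totatives d. f (real a / real d)) = (\<Sum>k\<in>{1..q}. f (real k / real q))"
proof -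
  have fin: "finite {d. d dvd q}" using q by (rule finite_divisors_nat)
  have "(\<Sum>d | d dvd q. \<Sum>a\<in>totatives d. f (real a / real d))
      = (\<Sum>g | g dvd q. \<Sum>a\<in>totatives (q div g). f (real a / real (q div g)))"
    by (rule sum.reindex_bij_witness[where i = "\<lambda>g. q div g" and j = "\<lambda>g. q div g"])
       (use q in \<open>auto simp: div_dvd_div div_div_eq_right\<close>)
  also have "\<dots> = (\<Sum>g | g dvd q. \<Sum>k\<in>{k\<in>{0<..q}. gcd k q = g}. f (real k / real q))"
  proof (rule sum.cong[OF refl])
    fix g assume "g \<in> {g. g dvd q}"
    then have g: "g dvd q" "g > 0" using q by (auto intro: dvd_pos_nat)
    have "(\<Sum>a\<in>totatives (q div g). f (real a / real (q div g)))
        = (\<Sum>a\<in>totatives (q div g). f (real (a * g) / real q))"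
      using g by (intro sum.cong) (auto simp: real_of_nat_div)
    also have "\<dots> = (\<Sum>k\<in>{k\<in>{0<..q}. gcd k q = g}. f (real k / real q))"
      by (rule sum.reindex_bij_betw[OF bij_betw_totatives_gcd_eq[OF g(1) q]])
    finally show "(\<Sum>a\<in>totatives (q div g). f (real a / real (q div g)))
        = (\<Sum>k\<in>{k\<in>{0<..q}. gcd k q = g}. f (real k / real q))" .
  qed
  also have "\<dots> = (\<Sum>k\<in>{0<..q}. f (real k / real q))"
    using fin by (intro sum.group) auto
  also have "{0<..q} = {1..q}" by auto
  finally show ?thesis .
qed

lemma sum_e_multiples:
  assumes q: "q > 0"
  shows "(\<Sum>k\<in>{1..q}. e (real n * (real k / real q))) = (if q dvd n then of_nat q else 0)"
proof (cases "q dvd n")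
  case True
  have "e (real n * (real k / real q)) = 1" for k
  proof -
    obtain j where "n = q * j" using True by (elim dvdE)
    then have "real n * (real k / real q) = real (j * k)" using q by simp
    then show ?thesis by (simp only: e_of_nat)
  qed
  then show ?thesis using True by simp
next
  case False
  let ?a = "real n / real q"
  have "e ?a \<noteq> 1"
  proof
    assume "e ?a = 1"
    then have "sin (pi * ?a) = 0" using norm_one_minus_e[of ?a] by simp
    then obtain i where "pi * ?a = of_int i * pi" by (auto simp: sin_zero_iff_int2)
    then have "pi * ?a = pi * of_int i" by (simp only: mult.commute)
    then have "?a = of_int i" by (simp only: mult_cancel_left) simp
    then have "real n = of_int (i * int q)" using q by (simp add: field_simps)
    then have "int n = i * int q" by (metis of_int_eq_iff of_int_of_nat_eq)
    then show False using False by (metis dvd_triv_right int_dvd_int_iff)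
  qed
  \<comment> \<open>The geometric sum is complete: \<open>e (q * ?a) = e n = 1\<close>.\<close>
  moreover have "dirichlet q ?a * (1 - e ?a) = 0"
    unfolding dirichlet_mult e_mult_of_nat[symmetric] using q by simp
  ultimately have "dirichlet q ?a = 0" by simp
  moreover have "(\<Sum>k\<in>{1..q}. e (real n * (real k / real q))) = (\<Sum>k\<in>{0<..q}. e (real k * ?a))"
    by (rule sum.cong) (auto simp: field_simps)
  ultimately show ?thesis using False by (simp only: sum_e_greaterThanAtMost) simp
qed

text \<open>Orthogonality keeps only the \<open>n\<close> divisible by \<open>q\<close>, with weight
  \<open>q\<close>; the hyperbola identity is then applied to the indicator of divisibility by
  \<open>q\<close>.\<close>

lemma sum_complete_fractions_tau:
  fixes N q :: nat
  defines "R \<equiv> {m. 0 < m \<and> m * m \<le> N}"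
  assumes q: "q > 0"
  shows "(\<Sum>k\<in>{1..q}. \<Sum>n\<in>{1..N}. of_nat (tau n) * e (real n * (real k / real q)))
    = of_real (2 * (\<Sum>m\<in>R. real q * real (card {n\<in>{m<..N div m}. q dvd m * n}))
        + real q * real (card {m\<in>R. q dvd m * m}))"
proof -
  let ?i = "\<lambda>n. if q dvd n then 1 else 0 :: real"
  have fR: "finite R" unfolding R_def by (rule card_squares_le)
  have "(\<Sum>k\<in>{1..q}. \<Sum>n\<in>{1..N}. of_nat (tau n) * e (real n * (real k / real q)))
    = (\<Sum>n\<in>{1..N}. of_nat (tau n) * (\<Sum>k\<in>{1..q}. e (real n * (real k / real q))))"
    unfolding sum_distrib_left by (rule sum.swap)
  also have "\<dots> = of_real (real q * (\<Sum>n\<in>{1..N}. of_nat (tau n) * ?i n))"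
    unfolding sum_e_multiples[OF q] sum_distrib_left of_real_sum by (intro sum.cong) auto
  also have "(\<Sum>n\<in>{1..N}. of_nat (tau n) * ?i n)
    = 2 * (\<Sum>m\<in>R. \<Sum>n\<in>{m<..N div m}. ?i (m * n)) + (\<Sum>m\<in>R. ?i (m * m))"
    unfolding R_def by (rule sum_tau_hyperbola)
  also have "(\<Sum>m\<in>R. \<Sum>n\<in>{m<..N div m}. ?i (m * n)) = (\<Sum>m\<in>R. real (card {n\<in>{m<..N div m}. q dvd m * n}))"
    by (simp add: sum.If_cases Int_def)
  also have "(\<Sum>m\<in>R. ?i (m * m)) = real (card {m\<in>R. q dvd m * m})"
    using fR by (simp add: sum.If_cases Int_def)
  finally show ?thesis by (simp add: algebra_simps sum_distrib_left)
qed

lemma sum_totatives_S_ge: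
  fixes N Q :: nat
  defines "T \<equiv> \<lambda>q. \<Sum>a\<in>totatives q. \<Sum>n\<in>{1..N}. of_nat (tau n) * e (real n * (real a / real q))"
  assumes QN: "Q ^ 2 \<le> N"
  shows "norm (\<Sum>q\<in>{1..Q}. T q) \<ge> real N * real Q / 2 - 4 * real Q ^ 3 - 12 * sqrt (real N) * real Q ^ 2"
proof -
  define R where "R = {m. 0 < m \<and> m * m \<le> N}"
  have R: "finite R" "real (card R) \<le> sqrt (real N)" unfolding R_def by (rule card_squares_le)+
  define c where "c m = real (card {m<..N div m})" for m
  define M where "M q = 2 * (\<Sum>m\<in>R. if q dvd m then real (totient q) * c m else 0)" for q
  have mdiv: "m \<le> N div m" if "m \<in> R" for m
    using that by (simp add: R_def less_eq_div_iff_mult_less_eq)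
  \<comment> \<open>The totients of the common divisors of \<open>q\<close> and \<open>m\<close> add
    up to \<open>gcd q m\<close>. So the divisor sums of \<open>M\<close> are exactly the main terms
    of \<open>card_dvd_mult_approx\<close>.\<close>
  have sumM: "(\<Sum>d | d dvd q. M d) = 2 * (\<Sum>m\<in>R. c m * real (gcd q m))" if "q > 0" for q
  proof -
    have inner: "(\<Sum>d | d dvd q. if d dvd m then real (totient d) * c m else 0) = c m * real (gcd q m)" for m
    proof -
      have "(\<Sum>d | d dvd q. if d dvd m then real (totient d) * c m else 0)
          = (\<Sum>d | d dvd gcd q m. real (totient d) * c m)"
        using that finite_divisors_nat[of q]
        by (intro sum.mono_neutral_cong_right) auto
      also have "\<dots> = real (\<Sum>d | d dvd gcd q m. totient d) * c m"
        by (simp add: sum_distrib_right)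
      finally show ?thesis by (simp only: totient_divisor_sum mult.commute)
    qed
    have "(\<Sum>d | d dvd q. M d) = 2 * (\<Sum>m\<in>R. \<Sum>d | d dvd q. if d dvd m then real (totient d) * c m else 0)"
      unfolding M_def sum_distrib_left[symmetric] by (subst sum.swap) (rule refl)
    also have "\<dots> = 2 * (\<Sum>m\<in>R. c m * real (gcd q m))" by (simp only: inner)
    finally show ?thesis .
  qed
  \<comment> \<open>\<open>M q\<close> is the contribution to \<open>T q\<close> of the \<open>m\<close> divisible by \<open>q\<close>, off the diagonal of the hyperbola.\<close>
  have "norm (\<Sum>d | d dvd q. T d - of_real (M d)) \<le> 3 * sqrt (real N) * real q" if q: "q > 0" for q
  proof -
    let ?A = "\<lambda>m. real q * real (card {n\<in>{m<..N div m}. q dvd m * n})"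
    let ?B = "real q * real (card {m\<in>R. q dvd m * m})"
    have "(\<Sum>d | d dvd q. T d) = (\<Sum>k\<in>{1..q}. \<Sum>n\<in>{1..N}. of_nat (tau n) * e (real n * (real k / real q)))"
      unfolding T_def by (rule sum_totatives_divisors[OF q])
    also have "\<dots> = of_real (2 * (\<Sum>m\<in>R. ?A m) + ?B)"
      unfolding R_def by (rule sum_complete_fractions_tau[OF q])
    finally have "(\<Sum>d | d dvd q. T d - of_real (M d)) = of_real (2 * (\<Sum>m\<in>R. ?A m) + ?B - (\<Sum>d | d dvd q. M d))"
      by (simp add: sum_subtractf)
    also have "\<dots> = of_real (2 * (\<Sum>m\<in>R. ?A m - c m * real (gcd q m)) + ?B)"
      unfolding sumM[OF q] by (simp add: sum_subtractf algebra_simps)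
    finally have "norm (\<Sum>d | d dvd q. T d - of_real (M d)) \<le> 2 * \<bar>\<Sum>m\<in>R. ?A m - c m * real (gcd q m)\<bar> + ?B"
      using abs_triangle_ineq[of "2 * (\<Sum>m\<in>R. ?A m - c m * real (gcd q m))" ?B] by (simp only: norm_of_real abs_mult)
    also have "\<bar>\<Sum>m\<in>R. ?A m - c m * real (gcd q m)\<bar> \<le> (\<Sum>m\<in>R. \<bar>?A m - c m * real (gcd q m)\<bar>)"
      by (rule sum_abs)
    also have "\<dots> \<le> (\<Sum>m\<in>R. real q)"
      unfolding c_def using q mdiv by (intro sum_mono card_dvd_mult_approx)
    also have "?B \<le> real q * real (card R)"
      using R by (intro mult_left_mono) (auto intro: card_mono)
    \<comment> \<open>Each \<open>m\<close> in \<open>R\<close> costs \<open>2 * q\<close> off the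
      diagonal and at most \<open>q\<close> on it.\<close>
    finally have "norm (\<Sum>d | d dvd q. T d - of_real (M d)) \<le> 3 * (real (card R) * real q)"
      by (simp add: mult.commute)
    also have "\<dots> \<le> 3 * (sqrt (real N) * real q)"
      using R by (intro mult_left_mono mult_right_mono) auto
    finally show ?thesis by simp
  qed
  then have err: "(\<Sum>q\<in>{1..Q}. norm (T q - of_real (M q))) \<le> 4 * (3 * sqrt (real N)) * real Q ^ 2"
    by (rule sum_norm_le_of_divisor_sums) auto
  \<comment> \<open>All terms of \<open>M q\<close> are nonnegative, and only \<open>m = q\<close>
    is kept. Its count is \<open>N div q - q\<close>, where rounding and subtraction together lose
    at most \<open>1 + q \<le> 2 * Q\<close>.\<close>
  have main: "M q \<ge> 2 * real N * (real (totient q) / real q) - 4 * real Q ^ 2" if q: "q \<in> {1..Q}" for q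
  proof -
    have "q * q \<le> Q ^ 2" using q by (simp add: power2_eq_square mult_mono)
    then have qR: "q \<in> R" using q QN by (simp add: R_def)
    have "real N / real q - 1 \<le> real (N div q)"
      using floor_divide_of_nat_eq[of N q, where ?'a = real] by linarith
    then have "c q \<ge> real N / real q - 2 * real Q"
      using mdiv[OF qR] q by (simp add: c_def)
    then have "real (totient q) * (real N / real q - 2 * real Q) \<le> real (totient q) * c q"
      by (intro mult_left_mono) auto
    also have "\<dots> \<le> (\<Sum>m\<in>R. if q dvd m then real (totient q) * c m else 0)"
      using member_le_sum[OF qR, of "\<lambda>m. if q dvd m then real (totient q) * c m else 0"] R(1)
      by (simp add: c_def)
    finally have "M q \<ge> 2 * (real (totient q) * (real N / real q - 2 * real Q))"
      by (simp add: M_def)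
    moreover have "real (totient q) * real Q \<le> real Q * real Q"
      using totient_le[of q] q by (intro mult_right_mono) auto
    ultimately show ?thesis by (simp add: algebra_simps power2_eq_square)
  qed
  have "real N * real Q / 2 - 4 * real Q ^ 3 \<le> 2 * real N * (\<Sum>q\<in>{1..Q}. real (totient q) / real q) - real Q * (4 * real Q ^ 2)"
    using mult_left_mono[OF sum_totient_over_ge[of Q], of "2 * real N"] by (simp add: power2_eq_square power3_eq_cube)
  also have "\<dots> = (\<Sum>q\<in>{1..Q}. 2 * real N * (real (totient q) / real q) - 4 * real Q ^ 2)"
    by (simp add: sum_subtractf sum_distrib_left)
  also have "\<dots> \<le> (\<Sum>q\<in>{1..Q}. M q)" by (intro sum_mono main)
  also have "\<dots> \<le> norm (of_real (\<Sum>q\<in>{1..Q}. M q) :: complex)" by (simp only: norm_of_real)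
  also have "of_real (\<Sum>q\<in>{1..Q}. M q) = (\<Sum>q\<in>{1..Q}. T q) - (\<Sum>q\<in>{1..Q}. T q - of_real (M q))"
    by (simp add: sum_subtractf)
  also have "norm \<dots> \<le> norm (\<Sum>q\<in>{1..Q}. T q) + norm (\<Sum>q\<in>{1..Q}. T q - of_real (M q))"
    by (rule norm_triangle_ineq4)
  also have "norm (\<Sum>q\<in>{1..Q}. T q - of_real (M q)) \<le> (\<Sum>q\<in>{1..Q}. norm (T q - of_real (M q)))"
    by (rule norm_sum)
  finally show ?thesis using err by simp
qed

text \<open>The \<open>L^1\<close> norm dominates every Fourier coefficient, in particular
  \<open>tau 1 = 1\<close>. This settles the small \<open>x\<close>, for which the Farey argument
  has no room.\<close>

lemma integral_norm_S_ge_1: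
  assumes "x \<ge> 1"
  shows "integral {0..1} (\<lambda>\<alpha>. norm (S x \<alpha>)) \<ge> 1"
proof -
  define N where "N = nat \<lfloor>x\<rfloor>"
  have N: "1 \<in> {1..N}" using assms by (simp add: N_def le_nat_floor)
  have S: "S x \<alpha> = (\<Sum>n\<in>{1..N}. of_nat (tau n) * e (real n * \<alpha>))" for \<alpha>
    using S_eq_sum[of x \<alpha>] assms by (simp add: N_def)
  have "((\<lambda>\<alpha>. \<Sum>n\<in>{1..N}. of_nat (tau n) * e (of_int (int n - 1) * \<alpha>))
      has_integral (\<Sum>n\<in>{1..N}. of_nat (tau n) * (if int n - 1 = 0 then 1 else 0))) {0..1}"
    by (intro has_integral_sum has_integral_mult_right has_integral_e_int) auto
  also have "(\<Sum>n\<in>{1..N}. of_nat (tau n) * (if int n - 1 = 0 then 1 else 0 :: complex))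
     = (\<Sum>n\<in>{1..N}. if n = 1 then 1 else 0)"
    by (intro sum.cong) (auto simp: tau_def)
  also have "\<dots> = 1" using N by simp
  also have "(\<lambda>\<alpha>. \<Sum>n\<in>{1..N}. of_nat (tau n) * e (of_int (int n - 1) * \<alpha>)) = (\<lambda>\<alpha>. S x \<alpha> * e (- \<alpha>))"
    unfolding S sum_distrib_right by (auto simp: algebra_simps fun_eq_iff simp flip: e_add intro!: sum.cong)
  finally have I: "((\<lambda>\<alpha>. S x \<alpha> * e (- \<alpha>)) has_integral 1) {0..1}" .
  have "norm (integral {0..1} (\<lambda>\<alpha>. S x \<alpha> * e (- \<alpha>))) \<le> integral {0..1} (\<lambda>\<alpha>. norm (S x \<alpha>))"
    unfolding S using I unfolding S
    by (intro integral_norm_bound_integral integrable_continuous_real continuous_intros) (auto simp: norm_mult)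
  then show ?thesis using I by (simp add: integral_unique)
qed

lemma integral_norm_S_ge:
  assumes x: "x \<ge> 2"
  shows "integral {0..1} (\<lambda>\<alpha>. norm (S x \<alpha>)) \<ge> sqrt x / 12000"
proof -
  define N where "N = nat \<lfloor>x\<rfloor>"
  have N: "real N \<le> x" "x \<le> real N + 1" "real N \<ge> 1" using x by (auto simp: N_def)
  define y where "y = sqrt (real N)"
  have y: "y \<ge> 1" "y ^ 2 = real N" using N by (auto simp: y_def)
  have "x \<le> (2 * y) ^ 2" using N y by (simp add: power_mult_distrib)
  then have sx: "sqrt x \<le> 2 * y" using y by (intro real_le_lsqrt) auto
  show ?thesis
  proof (cases "y < 60")
    case True
    then show ?thesis using sx integral_norm_S_ge_1[of x] x by linarith
  next
    case False
    \<comment> \<open>With \<open>Q \<le> y / 60\<close> the two error terms are at most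
      \<open>1 / 100\<close> and \<open>1 / 5\<close> of \<open>N * Q\<close>, so more than
      \<open>1 / 4\<close> of the main term's \<open>1 / 2\<close> survives. As
      \<open>y / 60 \<ge> 1\<close>, rounding down loses at most a factor 2, whence
      \<open>Q \<ge> y / 120\<close>.\<close>
    define Q where "Q = nat \<lfloor>y / 60\<rfloor>"
    have fl: "1 \<le> \<lfloor>y / 60\<rfloor>" using False by (simp add: le_floor_iff)
    then have Q1: "Q \<ge> 1" unfolding Q_def by arith
    from fl have "real Q = of_int \<lfloor>y / 60\<rfloor>" unfolding Q_def by (intro of_nat_nat) linarith
    then have "real Q \<le> y / 60" "y / 60 < real Q + 1" by linarith+
    moreover have "1 \<le> real Q" using Q1 by simp
    ultimately have Q: "real Q \<le> y / 60" "real Q \<ge> y / 120" "Q \<ge> 1" using Q1 by linarith+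
    have "real Q ^ 2 \<le> y ^ 2" using Q y by (intro power_mono) auto
    then have QN: "Q ^ 2 \<le> N" using y by (simp flip: of_nat_power)
    let ?I = "integral {0..1} (\<lambda>\<alpha>. norm (S x \<alpha>))"
    have "real N * real Q / 2 - 4 * real Q ^ 3 - 12 * sqrt (real N) * real Q ^ 2 \<le> 12 * real N * ?I"
      using order_trans[OF sum_totatives_S_ge[OF QN] norm_farey_sum_le_integral[OF Q(3) QN, of "\<lambda>n. of_nat (tau n)"]]
        S_eq_sum[of x] x by (simp add: N_def)
    moreover have "4 * real Q ^ 3 \<le> real N * real Q / 100"
    proof -
      have "real Q * real Q \<le> (y / 60) * (y / 60)" using Q y by (intro mult_mono) auto
      then have "real Q * (real Q * real Q) \<le> real Q * ((y / 60) * (y / 60))" by (intro mult_left_mono) auto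
      then have "real Q ^ 3 \<le> real N * real Q / 3600"
        unfolding y(2)[symmetric] by (simp add: power3_eq_cube power2_eq_square field_simps)
      moreover have "0 \<le> real N * real Q" by simp
      ultimately show ?thesis by linarith
    qed
    moreover have "12 * sqrt (real N) * real Q ^ 2 \<le> real N * real Q / 5"
    proof -
      have "(y * real Q) * real Q \<le> (y * real Q) * (y / 60)" using Q y by (intro mult_left_mono) auto
      then show ?thesis
        using y(1) unfolding y(2)[symmetric] by (simp add: power2_eq_square field_simps)
    qed
    moreover have "0 \<le> real N * real Q" by simp
    ultimately have "real N * real Q / 4 \<le> 12 * real N * ?I" by linarith
    then have "real N * (real Q / 4) \<le> real N * (12 * ?I)" by (simp add: mult_ac)
    then have "real Q / 4 \<le> 12 * ?I" using N(3) by (subst (asm) mult_le_cancel_left_pos) auto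
    \<comment> \<open>The integral is at least
      \<open>Q / 48 \<ge> y / 5760 \<ge> sqrt x / 11520\<close>, which explains the constant
      12000.\<close>
    then show ?thesis using Q sx by linarith
  qed
qed

theorem theorem1:
  shows "\<exists>c1 c2 :: real. c1 > 0 \<and> c2 > 0 \<and>
    (\<forall>x :: real. x \<ge> 2 \<longrightarrow>
      c1 * sqrt x \<le> integral {0..1} (\<lambda>\<alpha>. norm (S x \<alpha>)) \<and>
      integral {0..1} (\<lambda>\<alpha>. norm (S x \<alpha>)) \<le> c2 * sqrt x * ln x)"
  using integral_norm_S_le integral_norm_S_ge
  by (intro exI[of _ "1 / 12000"] exI[of _ 18]) auto

end
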